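(* The number of arithmetical structures on $\mathcal{P}_{2,n}$ is given by: \[|\mathrm{Arith}(\mathcal{P}_{2,n})| = 9C_{n+1}-16C_n+5C_{n-1}-C_{n-2}+ \sum_{j=2}^{\lfloor\frac{n+1}{4}\rfloor} C(n+1,4j).\] In particular, $\lim_{n \to \infty} \frac{|\mathrm{Arith}(\mathcal{P}_{2,n})|}{C_{n+1}} =\frac{76523}{14400} \approx 5.3141$.
   Context: An arithmetical structure on a graph $G$ is an assignment to each vertex of a nonnegative integer label such that the set of all labels has gcd $1$ and the label of each vertex divides the sum of the labels of its neighbors, counted with multiplicity. The graph $\mathcal{P}_{2,n}$ has vertices $a_1,a_2,b_1,\ldots,b_n$, a single edge between $a_1$ and $a_2$, a single edge between $b_i$ and $b_{i+1}$ ($1\le i<n$), and two edges between $a_1$ and $b_1$. $\mathrm{Arith}(\mathcal{P}_{2,n})$ is the set of arithmetical structures, counted with the two sides distinguished. $C_n=\frac{1}{n+1}\binom{2n}{n}$ is the $n$th Catalan number and $C(n,k)=\frac{k}{n}\binom{2n-k-1}{n-1}$. *)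

theory Defs
  imports Complex_Main "HOL-Library.Multiset" "HOL-Library.FuncSet"
begin

text \<open>Undirected loopless multigraphs: an edge is the two-element set of its end points, and
  parallel edges are recorded by the multiplicity of that set.\<close>

record 'a multigraph =
  vertices :: "'a set"
  edges :: "'a set multiset"

definition neighbor_sum :: "'a multigraph \<Rightarrow> ('a \<Rightarrow> nat) \<Rightarrow> 'a \<Rightarrow> nat" where
  "neighbor_sum G r v = (\<Sum>u\<in>vertices G. count (edges G) {v, u} * r u)"

text \<open>A labelling is a function on the vertex set; extensionality fixes its irrelevant values
  outside that set, so that labellings can be counted. Labels may be 0, as 0 divides 0.\<close>

definition Arith :: "'a multigraph \<Rightarrow> ('a \<Rightarrow> nat) set" where
  "Arith G = {r \<in> extensional (vertices G).
     Gcd (r ` vertices G) = 1 \<and> (\<forall>v\<in>vertices G. r v dvd neighbor_sum G r v)}"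

datatype pvertex = Va nat | Vb nat

definition P2 :: "nat \<Rightarrow> pvertex multigraph" where
  "P2 n = \<lparr>vertices = {Va 1, Va 2} \<union> Vb ` {1..n},
     edges = {#{Va 1, Va 2}, {Va 1, Vb 1}, {Va 1, Vb 1}#}
       + image_mset (\<lambda>i. {Vb i, Vb (i + 1)}) (mset_set {1..<n})\<rparr>"

definition catalan :: "nat \<Rightarrow> real" where
  "catalan n = 1 / (real n + 1) * real ((2 * n) choose n)"

text \<open>The numbers $C(n,k)$; meant for \<open>1 \<le> k \<le> n\<close>, where the subtractions do not truncate.\<close>

definition ballot :: "nat \<Rightarrow> nat \<Rightarrow> real" where
  "ballot n k = real k / real n * real ((2 * n - k - 1) choose (n - 1))"

end

theory Submission
  imports Defs "HOL-Analysis.Uniform_Limit" "HOL-Real_Asymp.Real_Asymp"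
begin

text \<open>
  Let \<open>x\<close> and \<open>y\<close> be the labels of \<open>a\<^sub>1\<close> and \<open>b\<^sub>1\<close>. The gcd condition forces \<open>x\<close> and \<open>y\<close> to be coprime,
  and then \<open>a\<^sub>2\<close> carries 1 or 2 according to the parity of \<open>x\<close>. The labels of
  \<open>b\<^sub>1, \<dots>, b\<^sub>n\<close> run through the ways of continuing \<open>2x, y\<close> such that each label divides the sum of
  its neighbours. If the strictly decreasing continuation (the Euclidean algorithm with negative
  remainders) has \<open>m\<close> positive terms after \<open>2x\<close>, the possible next labels, one for each
  \<open>j \<ge> 0\<close>, lead to continuations of length \<open>m - 1 + j\<close>. This is the recursion of the ballot numbers,
  so there are \<open>C(n, m)\<close> continuations of length \<open>n\<close>.

  It remains to count the pairs \<open>(x, y)\<close> with a given \<open>m\<close>. The shift \<open>y \<mapsto> y + 2x\<close> raises \<open>m\<close> by one, and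
  the pairs with \<open>y < 2x\<close> form six one-parameter families. One of them has \<open>m = 4z - 1\<close>,
  which produces the sum over \<open>C(n + 1, 4j)\<close>; the others contribute quasi-linearly in \<open>m\<close>.
  The limit follows from Tannery's theorem, since \<open>C(n, k) / C\<^sub>n\<close> tends to \<open>k / 2\<^sup>k\<^sup>+\<^sup>1\<close> and
  is at most \<open>k / 2\<^sup>k\<^sup>-\<^sup>1\<close>.
\<close>

section \<open>Continuations of a pair of labels\<close>

text \<open>For \<open>q > 0\<close> this is the length of the Hirzebruch-Jung continued fraction of
  \<open>p / q\<close>; \<open>(q - p mod q) mod q\<close> is the residue of \<open>-p\<close>
  modulo \<open>q\<close>.\<close>

function euclid_length :: "nat \<Rightarrow> nat \<Rightarrow> nat" where
  "euclid_length p q =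
     (if q = 0 then 0 else Suc (euclid_length q ((q - p mod q) mod q)))"
  by auto
termination by (relation "measure snd") auto

declare euclid_length.simps [simp del]

lemma euclid_length_0 [simp]: "euclid_length p 0 = 0"
  by (simp add: euclid_length.simps)

lemma euclid_length_eq_0_iff [simp]: "euclid_length p q = 0 \<longleftrightarrow> q = 0"
  by (simp add: euclid_length.simps[of p q])

lemma neg_mod_unique:
  fixes p q c :: nat
  assumes "c < q" "q dvd p + c"
  shows "(q - p mod q) mod q = c"
proof -
  have lt: "p mod q < q" using assms by auto
  have "q dvd p mod q + c"
    using assms(2) by (simp add: dvd_eq_mod_eq_0 mod_simps)
  then obtain k where k: "p mod q + c = q * k" by auto
  have "q * k < q * 2" using k lt assms(1) by linarith
  then have "k < 2" by (metis mult_less_cancel1)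
  then have "k = 0 \<or> k = 1" by auto
  then show ?thesis
  proof
    assume "k = 0" then show ?thesis using k by simp
  next
    assume "k = 1"
    then have "q - p mod q = c" using k by simp
    then show ?thesis using assms(1) by simp
  qed
qed

lemma euclid_length_step:
  assumes "c < q" "q dvd p + c"
  shows "euclid_length p q = Suc (euclid_length q c)"
  using assms neg_mod_unique[OF assms] by (simp add: euclid_length.simps[of p q])

lemma euclid_length_cong:
  assumes "p mod q = p' mod q"
  shows "euclid_length p q = euclid_length p' q"
  using assms by (simp add: euclid_length.simps[of _ q])

text \<open>After \<open>p, q + p\<close> comes \<open>q\<close>, since \<open>q + p\<close> divides
  \<open>p + q\<close>. From there on only \<open>q + p\<close> modulo \<open>q\<close> matters, and
  this is \<open>p\<close> modulo \<open>q\<close>.\<close>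

lemma euclid_length_add:
  assumes "p > 0"
  shows "euclid_length p (q + p) = Suc (euclid_length p q)"
proof -
  have "euclid_length p (q + p) = Suc (euclid_length (q + p) q)"
    using assms by (intro euclid_length_step) (auto simp: add.commute)
  also have "euclid_length (q + p) q = euclid_length p q"
    by (rule euclid_length_cong) simp
  finally show ?thesis .
qed

lemma euclid_length_add_mult:
  assumes "p > 0"
  shows "euclid_length p (q + j * p) = euclid_length p q + j"
proof (induction j)
  case (Suc j)
  have "q + Suc j * p = (q + j * p) + p" by simp
  then show ?case using Suc euclid_length_add[OF assms, of "q + j * p"] by (simp only:)
qed simp

text \<open>The Catalan triangle, in the additive form in which it counts continuations;
  \<open>ballot_nat_eq_ballot\<close> identifies it with C(n,k). Row 0 counts the empty
  continuation.\<close>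

primrec ballot_nat :: "nat \<Rightarrow> nat \<Rightarrow> nat" where
  "ballot_nat 0 = (\<lambda>k. if k = 0 then 1 else 0)"
| "ballot_nat (Suc n) = (\<lambda>k. case k of 0 \<Rightarrow> 0 | Suc k \<Rightarrow> \<Sum>m = k..n. ballot_nat n m)"

declare ballot_nat.simps(2) [simp del]

lemma ballot_nat_Suc_0 [simp]: "ballot_nat (Suc n) 0 = 0"
  by (simp add: ballot_nat.simps)

lemma ballot_nat_Suc_Suc: "ballot_nat (Suc n) (Suc k) = (\<Sum>m = k..n. ballot_nat n m)"
  by (simp add: ballot_nat.simps)

lemma ballot_nat_eq_0: "n < k \<Longrightarrow> ballot_nat n k = 0"
  by (cases n; cases k) (simp_all add: ballot_nat_Suc_Suc)

lemma ballot_nat_rec: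
  "ballot_nat (Suc n) (Suc k) = ballot_nat n k + ballot_nat (Suc n) (Suc (Suc k))"
proof (cases "k \<le> n")
  case True
  then show ?thesis by (simp add: ballot_nat_Suc_Suc sum.atLeast_Suc_atMost)
qed (simp add: ballot_nat_eq_0)

text \<open>The labels along the path, shifted to start at index 0 and padded with 0; \<open>case_nat p c i\<close> is the
  predecessor of \<open>c i\<close>, with \<open>p\<close> the total contribution of \<open>a\<^sub>1\<close> to the neighbour sum of \<open>b\<^sub>1\<close>.\<close>

definition tails :: "nat \<Rightarrow> nat \<Rightarrow> nat \<Rightarrow> (nat \<Rightarrow> nat) set" where
  "tails n p q = {c. c 0 = q \<and> (\<forall>i\<ge>n. c i = 0) \<and>
     (\<forall>i<n. c i > 0 \<and> c i dvd case_nat p c i + c (Suc i))}"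

lemma tails_0: "tails 0 p q = (if q = 0 then {\<lambda>_. 0} else {})"
  by (auto simp: tails_def)

lemma tails_Suc:
  "tails (Suc n) p q = (if q = 0 then {} else
     (\<Union>q' \<in> {q'. q dvd p + q'}. case_nat q ` tails n q q'))"
proof (cases "q = 0")
  case True
  then show ?thesis by (auto simp: tails_def)
next
  case False
  show ?thesis
  proof (intro equalityI subsetI)
    fix c assume c: "c \<in> tails (Suc n) p q"
    define d where "d = c \<circ> Suc"
    have cd: "c = case_nat q d"
      using c by (auto simp: d_def tails_def fun_eq_iff split: nat.splits)
    have "c 0 dvd case_nat p c 0 + c (Suc 0)" using c unfolding tails_def by blast
    then have "q dvd p + d 0" using c by (simp add: tails_def d_def)
    moreover have "d \<in> tails n q (d 0)"
      unfolding tails_def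
    proof (safe)
      fix i assume "n \<le> i"
      then show "d i = 0" using c by (simp add: tails_def d_def)
    next
      fix i assume "i < n"
      then show "0 < d i" using c by (simp add: tails_def d_def)
    next
      fix i assume "i < n"
      then have "c (Suc i) dvd case_nat p c (Suc i) + c (Suc (Suc i))"
        using c unfolding tails_def by blast
      then show "d i dvd case_nat q d i + d (Suc i)"
        by (simp add: cd)
    qed
    ultimately show "c \<in> (if q = 0 then {} else
     (\<Union>q' \<in> {q'. q dvd p + q'}. case_nat q ` tails n q q'))"
      using False cd by auto
  next
    fix c assume "c \<in> (if q = 0 then {} else
     (\<Union>q' \<in> {q'. q dvd p + q'}. case_nat q ` tails n q q'))"
    then obtain q' d where d: "q dvd p + q'" "d \<in> tails n q q'" "c = case_nat q d"
      using False by auto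
    then show "c \<in> tails (Suc n) p q"
      using False unfolding tails_def
      by (auto split: nat.splits simp: less_Suc_eq_0_disj)
  qed
qed

text \<open>The possible next labels are \<open>c + j * q\<close>, of Euclidean length
  \<open>m + j\<close>, so the counts add up to the defining sum of \<open>ballot_nat\<close>.
  Finiteness belongs to the induction: only for a finite set does cardinality 0 mean empty.\<close>

lemma finite_card_tails:
  "finite (tails n p q) \<and> card (tails n p q) = ballot_nat n (euclid_length p q)"
proof (induction n arbitrary: p q)
  case 0
  show ?case by (simp add: tails_0)
next
  case (Suc n)
  show ?case
  proof (cases "q = 0")
    case True
    then show ?thesis by (simp add: tails_Suc)
  next
    case False
    define c where "c = (q - p mod q) mod q"
    define m where "m = euclid_length q c"
    have c: "c < q" "q dvd p + c"
    proof -
      show "c < q" using False by (simp add: c_def)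
      have "(p + c) mod q = (p mod q + (q - p mod q)) mod q"
        unfolding c_def by presburger
      also have "\<dots> = 0" using False by (simp add: less_imp_le)
      finally show "q dvd p + c" by auto
    qed
    have len: "euclid_length p q = Suc m"
      using euclid_length_step[OF c] by (simp add: m_def)
    have residues: "\<exists>j. q' = c + j * q" if "q dvd p + q'" for q'
    proof -
      have "q' mod q = c"
      proof -
        have "q' mod q < q" using False by simp
        moreover have "q dvd p + q' mod q"
          using that by (simp add: dvd_eq_mod_eq_0 mod_simps)
        ultimately show ?thesis using neg_mod_unique c_def by metis
      qed
      then show ?thesis by (metis mod_div_mult_eq)
    qed
    have lenj: "euclid_length q (c + (i - m) * q) = i" if "m \<le> i" for i
      using that False euclid_length_add_mult[of q c "i - m"] by (simp add: m_def)
    \<comment> \<open>Indexed by the Euclidean length \<open>i\<close> of the remaining tail.\<close>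
    define F where "F i = case_nat q ` tails n q (c + (i - m) * q)" for i
    \<comment> \<open>Of the infinitely many \<open>q'\<close> only those of Euclidean length at
      most \<open>n\<close> have a continuation of length \<open>n\<close>.\<close>
    have "tails (Suc n) p q = (\<Union>i \<in> {m..n}. F i)"
    proof (intro equalityI subsetI)
      fix f assume "f \<in> tails (Suc n) p q"
      then obtain q' where q': "q dvd p + q'" "f \<in> case_nat q ` tails n q q'"
        using False by (auto simp: tails_Suc)
      obtain j where j: "q' = c + j * q" using residues q' by blast
      have len': "euclid_length q q' = m + j"
        using False j euclid_length_add_mult[of q c j] by (simp add: m_def)
      have "tails n q q' \<noteq> {}" using q' by auto
      then have "card (tails n q q') \<noteq> 0" using Suc card_0_eq by metis
      then have "ballot_nat n (m + j) \<noteq> 0" using Suc len' by metis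
      then have "m + j \<le> n" by (metis ballot_nat_eq_0 not_le)
      then show "f \<in> (\<Union>i \<in> {m..n}. F i)"
        using q'(2) j by (intro UN_I[of "m + j"]) (auto simp: F_def)
    next
      fix f assume "f \<in> (\<Union>i \<in> {m..n}. F i)"
      then obtain i where "f \<in> F i" by auto
      moreover have "q dvd p + (c + (i - m) * q)"
        using c(2) by (metis add.assoc dvd_add dvd_triv_right)
      ultimately show "f \<in> tails (Suc n) p q"
        using False unfolding tails_Suc F_def by auto
    qed
    moreover have "finite (F i)" for i
      using Suc by (simp add: F_def)
    moreover have "card (F i) = ballot_nat n i" if "i \<in> {m..n}" for i
    proof -
      have "inj (case_nat q :: (nat \<Rightarrow> nat) \<Rightarrow> _)"
        by (rule injI) (metis old.nat.simps(5) ext)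
      then have "card (F i) = card (tails n q (c + (i - m) * q))"
        unfolding F_def by (intro card_image) (metis inj_on_subset subset_UNIV)
      then show ?thesis using Suc lenj that by simp
    qed
    moreover have "F i \<inter> F j = {}" if "i \<in> {m..n}" "j \<in> {m..n}" "i \<noteq> j" for i j
    proof -
      \<comment> \<open>Entry 1 is the next label, and different lengths come from different next
        labels.\<close>
      have "f (Suc 0) = c + (i - m) * q" if "f \<in> F i" for f i
        using that by (auto simp: F_def tails_def)
      moreover have "c + (i - m) * q \<noteq> c + (j - m) * q" using that lenj
        by (metis atLeastAtMost_iff)
      ultimately show ?thesis by (metis disjoint_iff)
    qed
    ultimately show ?thesis
      by (simp add: card_UN_disjoint len ballot_nat_Suc_Suc)
  qed
qed

lemma finite_tails: "finite (tails n p q)"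
  and card_tails: "card (tails n p q) = ballot_nat n (euclid_length p q)"
  by (simp_all add: finite_card_tails)

section \<open>Arithmetical structures as pairs with a continuation\<close>

lemma count_path_edges:
  "count (image_mset (\<lambda>i. {Vb i, Vb (i + 1)}) (mset_set {1..<n})) X =
     (if \<exists>i\<in>{1..<n}. X = {Vb i, Vb (i + 1)} then 1 else 0)"
proof -
  \<comment> \<open>The path edges are pairwise distinct, so each has multiplicity 1.\<close>
  have "inj_on (\<lambda>i. {Vb i, Vb (i + 1)}) {1..<n}"
    by (auto simp: inj_on_def doubleton_eq_iff)
  then show ?thesis
    by (auto simp: image_mset_mset_set count_mset_set')
qed

lemma count_edges_P2:
  "count (edges (P2 n)) X =
     (if X = {Va 1, Va 2} then 1 else 0) + (if X = {Va 1, Vb 1} then 2 else 0)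
     + (if \<exists>i\<in>{1..<n}. X = {Vb i, Vb (i + 1)} then 1 else 0)"
  using count_path_edges[of n X] by (simp add: P2_def)

lemma sum_vertices_P2:
  fixes f :: "pvertex \<Rightarrow> nat"
  shows "sum f (vertices (P2 n)) = f (Va 1) + f (Va 2) + (\<Sum>i = 1..n. f (Vb i))"
proof -
  have "sum f (vertices (P2 n)) = sum f {Va 1, Va 2} + sum f (Vb ` {1..n})"
    unfolding P2_def multigraph.simps by (rule sum.union_disjoint) auto
  also have "sum f (Vb ` {1..n}) = (\<Sum>i = 1..n. f (Vb i))"
    by (subst sum.reindex) (auto simp: inj_on_def)
  finally show ?thesis by simp
qed

lemma neighbor_sum_P2_Va1:
  assumes "n \<ge> 1"
  shows "neighbor_sum (P2 n) r (Va 1) = r (Va 2) + 2 * r (Vb 1)"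
proof -
  have "(\<Sum>i = 1..n. count (edges (P2 n)) {Va 1, Vb i} * r (Vb i))
      = (\<Sum>i = 1..n. if i = 1 then 2 * r (Vb 1) else 0)"
    by (intro sum.cong) (auto simp: count_edges_P2 doubleton_eq_iff)
  also have "\<dots> = 2 * r (Vb 1)" using assms by simp
  finally show ?thesis
    by (simp add: neighbor_sum_def sum_vertices_P2 count_edges_P2 doubleton_eq_iff)
qed

lemma neighbor_sum_P2_Va2: "neighbor_sum (P2 n) r (Va 2) = r (Va 1)"
  by (simp add: neighbor_sum_def sum_vertices_P2 count_edges_P2 doubleton_eq_iff)

text \<open>The padding by 0 lets the last vertex of the path obey the same neighbour formula as the
  inner ones.\<close>

definition b_labels :: "nat \<Rightarrow> (pvertex \<Rightarrow> nat) \<Rightarrow> nat \<Rightarrow> nat" where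
  "b_labels n r i = (if i < n then r (Vb (Suc i)) else 0)"

lemma neighbor_sum_P2_Vb:
  assumes "i < n"
  shows "neighbor_sum (P2 n) r (Vb (Suc i)) =
    case_nat (2 * r (Va 1)) (b_labels n r) i + b_labels n r (Suc i)"
proof -
  \<comment> \<open>For \<open>i = 0\<close> the left neighbour is \<open>Va 1\<close>, which lies
    outside this sum; for \<open>i = n - 1\<close> there is no right neighbour, and the index
    exceeds \<open>n\<close>.\<close>
  have "(\<Sum>j = 1..n. count (edges (P2 n)) {Vb (Suc i), Vb j} * r (Vb j))
      = (\<Sum>j = 1..n. (if j = i then r (Vb i) else 0)
          + (if j = Suc (Suc i) then r (Vb (Suc (Suc i))) else 0))"
    using assms by (intro sum.cong) (auto simp: count_edges_P2 doubleton_eq_iff)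
  also have "\<dots> = (if i = 0 then 0 else r (Vb i)) + b_labels n r (Suc i)"
    using assms by (simp add: sum.distrib b_labels_def)
  finally show ?thesis using assms
    by (auto simp: neighbor_sum_def sum_vertices_P2 count_edges_P2 doubleton_eq_iff
        b_labels_def split: nat.splits)
qed

text \<open>The conditions at \<open>Va 1\<close> and \<open>Va 2\<close>, with coprimality, after
  the label of \<open>Va 2\<close> (1 for odd \<open>x\<close>, 2 for even \<open>x\<close>) has
  been eliminated; see \<open>admissible_iff\<close>. In the even case \<open>odd y\<close> carries
  the coprimality at the prime 2.\<close>

definition admissible :: "nat \<Rightarrow> nat \<Rightarrow> bool" where
  "admissible x y \<longleftrightarrow> x > 0 \<and> (odd x \<and> x dvd 2 * y + 1 \<or> (\<exists>z. x = 2 * z \<and> odd y \<and> z dvd y + 1))"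

lemma admissible_coprime:
  assumes "admissible x y"
  shows "coprime x y"
proof -
  consider "odd x" "x dvd 2 * y + 1" | z where "x = 2 * z" "odd y" "z dvd y + 1"
    using assms by (auto simp: admissible_def)
  then show ?thesis
  proof cases
    case 1
    then have "coprime x (2 * y)"
      by (metis coprime_Suc_left_nat coprime_divisors dvd_refl Suc_eq_plus1)
    then show ?thesis by simp
  next
    case 2
    then have "coprime z y"
      by (metis coprime_Suc_left_nat coprime_divisors dvd_refl Suc_eq_plus1)
    then show ?thesis using 2 by simp
  qed
qed

lemma admissible_iff:
  "admissible x y \<longleftrightarrow> x > 0 \<and> coprime x y \<and>
     (let a = if even x then 2 else 1 in a dvd x \<and> x dvd a + 2 * y)"
proof (cases "even x")
  case True
  then obtain z where z: "x = 2 * z" by auto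
  have "2 * z dvd 2 + 2 * y \<longleftrightarrow> 2 * z dvd 2 * (y + 1)" by (simp add: algebra_simps)
  also have "\<dots> \<longleftrightarrow> z dvd y + 1" by (simp only: nat_mult_dvd_cancel_disj) simp
  finally have "2 * z dvd 2 + 2 * y \<longleftrightarrow> z dvd y + 1" .
  moreover have "odd y" if "coprime (2 * z) y" using that by simp
  ultimately show ?thesis
    using z admissible_coprime[of x y] by (auto simp: admissible_def)
next
  case False
  then show ?thesis using admissible_coprime[of x y]
    by (auto simp: admissible_def add.commute)
qed

text \<open>\<open>a\<close> divides \<open>x\<close>, hence \<open>2 * y\<close>, and is coprime to
  \<open>y\<close>, so it divides 2. If \<open>a = 1\<close>, then \<open>x\<close> divides an odd
  number.\<close>

lemma admissible_unique_a:
  fixes a x y :: nat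
  assumes "coprime x y" "a dvd x" "x dvd a + 2 * y"
  shows "a = (if even x then 2 else 1)"
proof -
  have "a dvd 2 * y" using assms(2,3) by (metis dvd_add_right_iff dvd_refl dvd_trans)
  moreover have "coprime a y" using assms(1,2) by (metis coprime_divisors dvd_refl)
  ultimately have "a dvd 2" by (simp add: coprime_dvd_mult_left_iff)
  then have "a = 1 \<or> a = 2"
    by (metis dvd_0_left_iff dvd_imp_le le_neq_implies_less less_2_cases zero_neq_numeral zero_less_numeral One_nat_def)
  moreover have "odd x" if "a = 1"
    using assms(3) that by (metis dvd_trans even_Suc dvd_triv_left plus_1_eq_Suc)
  ultimately show ?thesis using assms(2) by auto
qed

text \<open>Since 0 divides only 0, the case \<open>d = 0\<close> says that two adjacent zeros propagate.\<close>

lemma chain_dvd: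
  fixes c :: "nat \<Rightarrow> nat"
  assumes "\<And>i. i < n \<Longrightarrow> c i dvd case_nat p c i + c (Suc i)" "d dvd p" "d dvd c 0" "i \<le> n"
  shows "d dvd case_nat p c i \<and> d dvd c i"
  using assms(4)
proof (induction i)
  case (Suc i)
  then have "d dvd case_nat p c i" "d dvd c i" by auto
  moreover have "c i dvd case_nat p c i + c (Suc i)" using Suc.prems assms(1) by auto
  ultimately have "d dvd c (Suc i)" by (metis dvd_add_right_iff dvd_trans)
  then show ?case using \<open>d dvd c i\<close> by simp
qed (use assms in auto)

text \<open>Since 0 divides only 0, the predecessor of a label 0 would vanish as well, all the way
  down to \<open>p\<close>.\<close>

lemma chain_pos:
  fixes c :: "nat \<Rightarrow> nat"
  assumes "\<And>i. i < n \<Longrightarrow> c i dvd case_nat p c i + c (Suc i)" "p > 0" "i < n"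
  shows "c i > 0"
  using assms(3)
proof (induction i)
  case 0
  then have "c 0 dvd p + c (Suc 0)" using assms(1)[of 0] by simp
  then show ?case using assms(2) by (cases "c 0 = 0") auto
next
  case (Suc i)
  then have "c (Suc i) dvd c i + c (Suc (Suc i))" using assms(1)[of "Suc i"] by simp
  then show ?case using Suc by (cases "c (Suc i) = 0") auto
qed

lemma ball_vertices_P2:
  "(\<forall>v\<in>vertices (P2 n). Q v) \<longleftrightarrow> Q (Va 1) \<and> Q (Va 2) \<and> (\<forall>i<n. Q (Vb (Suc i)))"
proof -
  have "{1..n} = Suc ` {..<n}" by (metis lessThan_atLeast0 image_Suc_lessThan)
  then show ?thesis by (auto simp: P2_def simp flip: One_nat_def)
qed

lemma divisibility_P2:
  assumes "n \<ge> 1"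
  shows "(\<forall>v\<in>vertices (P2 n). r v dvd neighbor_sum (P2 n) r v) \<longleftrightarrow>
    r (Va 1) dvd r (Va 2) + 2 * r (Vb 1) \<and> r (Va 2) dvd r (Va 1) \<and>
    (\<forall>i<n. b_labels n r i dvd case_nat (2 * r (Va 1)) (b_labels n r) i + b_labels n r (Suc i))"
  using assms
  by (simp add: ball_vertices_P2 neighbor_sum_P2_Va1 neighbor_sum_P2_Va2 neighbor_sum_P2_Vb
        del: One_nat_def)
    (simp add: b_labels_def del: One_nat_def)

lemma Arith_P2_iff:
  assumes n: "n \<ge> 1"
  shows "r \<in> Arith (P2 n) \<longleftrightarrow> r \<in> extensional (vertices (P2 n)) \<and>
    admissible (r (Va 1)) (r (Vb 1)) \<and> r (Va 2) = (if even (r (Va 1)) then 2 else 1) \<and>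
    b_labels n r \<in> tails n (2 * r (Va 1)) (r (Vb 1))"
    (is "_ \<longleftrightarrow> ?rhs")
proof
  define x a y c where "x = r (Va 1)" "a = r (Va 2)" "y = r (Vb 1)" "c = b_labels n r"
  note defs = this
  have c0: "c 0 = y" and c_end: "\<forall>i\<ge>n. c i = 0"
    using n by (auto simp: defs b_labels_def)
  {
    assume r: "r \<in> Arith (P2 n)"
    then have ext: "r \<in> extensional (vertices (P2 n))" and gcd: "Gcd (r ` vertices (P2 n)) = 1"
      and xa: "x dvd a + 2 * y" and ax: "a dvd x"
      and chain: "\<And>i. i < n \<Longrightarrow> c i dvd case_nat (2 * x) c i + c (Suc i)"
      using divisibility_P2[OF n, of r] unfolding Arith_def defs by blast+
    define d where "d = gcd x y"
    have "d dvd x" "d dvd y" by (simp_all add: d_def)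
    then have "d dvd a"
      using xa by (metis dvd_add_left_iff dvd_mult dvd_trans)
    \<comment> \<open>The common divisor of the labels of \<open>Va 1\<close> and
      \<open>Vb 1\<close> spreads to all labels, so the gcd condition makes it 1.\<close>
    have "d dvd c i" if "i \<le> n" for i
      using chain_dvd[OF chain _ _ that] \<open>d dvd x\<close> \<open>d dvd y\<close> c0 by auto
    then have "\<forall>v\<in>vertices (P2 n). d dvd r v"
      using \<open>d dvd x\<close> \<open>d dvd a\<close> unfolding ball_vertices_P2
      by (auto simp: defs b_labels_def) (metis less_imp_le)
    then have "d dvd Gcd (r ` vertices (P2 n))" by (auto intro: Gcd_greatest)
    then have cop: "coprime x y" using gcd by (simp add: d_def coprime_iff_gcd_eq_1)
    \<comment> \<open>If \<open>x = 0\<close>, then 0 divides \<open>a + 2 * y\<close>, which forces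
      \<open>y = 0\<close> against coprimality.\<close>
    have "x > 0"
    proof (rule ccontr)
      assume "\<not> x > 0"
      then have "x = 0" "y = 0" using xa by auto
      then show False using cop by simp
    qed
    have a: "a = (if even x then 2 else 1)" using admissible_unique_a[OF cop ax xa] .
    then have "admissible x y"
      using cop ax xa \<open>x > 0\<close> by (simp add: admissible_iff Let_def)
    moreover have "c \<in> tails n (2 * x) y"
      using chain chain_pos[OF chain] \<open>x > 0\<close> c0 c_end by (simp add: tails_def)
    ultimately show ?rhs using ext a by (simp add: defs)
  }
  assume rhs: ?rhs
  then have ext: "r \<in> extensional (vertices (P2 n))" and adm: "admissible x y"
    and a: "a = (if even x then 2 else 1)" and c: "c \<in> tails n (2 * x) y"
    by (simp_all add: defs)
  from adm a have "a dvd x" "x dvd a + 2 * y"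
    by (simp_all add: admissible_iff Let_def)
  then have "\<forall>v\<in>vertices (P2 n). r v dvd neighbor_sum (P2 n) r v"
    unfolding divisibility_P2[OF n] using c by (simp add: tails_def defs del: One_nat_def)
  moreover have "Gcd (r ` vertices (P2 n)) = 1"
  proof -
    have "Va 1 \<in> vertices (P2 n)" "Vb 1 \<in> vertices (P2 n)" using n by (auto simp: P2_def)
    then have "Gcd (r ` vertices (P2 n)) dvd x" "Gcd (r ` vertices (P2 n)) dvd y"
      by (auto simp: defs intro!: Gcd_dvd)
    then show ?thesis using admissible_coprime[OF adm] by (metis coprime_common_divisor nat_dvd_1_iff_1)
  qed
  ultimately show "r \<in> Arith (P2 n)" using ext by (simp add: Arith_def)
qed

section \<open>Fibration of the structures over the pairs of labels\<close>

definition heads :: "nat \<Rightarrow> (nat \<times> nat) set" where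
  "heads m = {(x, y). admissible x y \<and> euclid_length (2 * x) y = m}"

text \<open>The inverse map for \<open>bij_betw_Arith\<close>: the label of \<open>Va 2\<close> is
  recovered from the parity of \<open>x\<close>, and \<open>restrict\<close> makes the labelling
  extensional.\<close>

definition labels_of :: "nat \<Rightarrow> nat \<Rightarrow> (nat \<Rightarrow> nat) \<Rightarrow> pvertex \<Rightarrow> nat" where
  "labels_of n x c = restrict (case_pvertex
     (\<lambda>i. if i = 1 then x else if even x then 2 else 1) (\<lambda>i. c (i - 1))) (vertices (P2 n))"

lemma bij_betw_Arith:
  assumes n: "n \<ge> 1"
  shows "bij_betw (\<lambda>r. (r (Va 1), b_labels n r)) (Arith (P2 n))
     {(x, c). admissible x (c 0) \<and> c \<in> tails n (2 * x) (c 0)}"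
proof (rule bij_betw_byWitness[where f' = "\<lambda>(x, c). labels_of n x c"])
  have b0: "b_labels n r 0 = r (Vb 1)" for r using n by (simp add: b_labels_def)
  show "\<forall>r\<in>Arith (P2 n). (\<lambda>(x, c). labels_of n x c) (r (Va 1), b_labels n r) = r"
  proof
    fix r assume "r \<in> Arith (P2 n)"
    then have r: "r \<in> extensional (vertices (P2 n))" "r (Va 2) = (if even (r (Va 1)) then 2 else 1)"
      by (simp_all add: Arith_P2_iff n del: One_nat_def)
    have "\<forall>v\<in>vertices (P2 n). labels_of n (r (Va 1)) (b_labels n r) v = r v"
      unfolding ball_vertices_P2 using r(2)
      by (auto simp: labels_of_def b_labels_def P2_def)
    then have "labels_of n (r (Va 1)) (b_labels n r) = r"
      using r(1) by (intro extensionalityI[of _ "vertices (P2 n)"]) (auto simp: labels_of_def)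
    then show "(\<lambda>(x, c). labels_of n x c) (r (Va 1), b_labels n r) = r" by simp
  qed
  have lab: "labels_of n x c (Va 1) = x" "b_labels n (labels_of n x c) = c"
    "labels_of n x c (Va 2) = (if even x then 2 else 1)" "labels_of n x c (Vb 1) = c 0"
    "labels_of n x c \<in> extensional (vertices (P2 n))"
    if "c \<in> tails n (2 * x) (c 0)" for x c
    using that n by (auto simp: labels_of_def b_labels_def P2_def tails_def fun_eq_iff)
  show "\<forall>p\<in>{(x, c). admissible x (c 0) \<and> c \<in> tails n (2 * x) (c 0)}.
      (((\<lambda>(x, c). labels_of n x c) p) (Va 1), b_labels n ((\<lambda>(x, c). labels_of n x c) p)) = p"
    using lab by auto
  show "(\<lambda>r. (r (Va 1), b_labels n r)) ` Arith (P2 n)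
      \<subseteq> {(x, c). admissible x (c 0) \<and> c \<in> tails n (2 * x) (c 0)}"
    using b0 by (auto simp: Arith_P2_iff n simp del: One_nat_def)
  show "(\<lambda>(x, c). labels_of n x c) ` {(x, c). admissible x (c 0) \<and> c \<in> tails n (2 * x) (c 0)}
      \<subseteq> Arith (P2 n)"
    using lab by (auto simp: Arith_P2_iff n simp del: One_nat_def)
qed

text \<open>The fibre over a pair \<open>(x, y)\<close> is a set of tails, counted by a ballot
  number; it is empty when the Euclidean length exceeds \<open>n\<close>.\<close>

lemma card_Arith_P2:
  assumes n: "n \<ge> 1" and fin: "\<And>m. finite (heads m)"
  shows "card (Arith (P2 n)) = (\<Sum>m\<le>n. card (heads m) * ballot_nat n m)"
proof -
  define T where "T = {(x, c). admissible x (c 0) \<and> c \<in> tails n (2 * x) (c 0)}"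
  define H where "H = (\<Union>m\<le>n. heads m)"
  define F where "F = (\<lambda>(x, y). Pair x ` tails n (2 * x) y)"
  have card_F: "card (F h) = ballot_nat n m" if "h \<in> heads m" for h m
    using that by (auto simp: F_def heads_def card_image inj_on_def card_tails)
  have "T = (\<Union>h\<in>H. F h)"
  proof (intro equalityI subsetI)
    fix t assume "t \<in> T"
    then obtain x c where t: "t = (x, c)" "admissible x (c 0)" "c \<in> tails n (2 * x) (c 0)"
      by (auto simp: T_def)
    have "card (tails n (2 * x) (c 0)) \<noteq> 0" using t(3) finite_tails card_0_eq by blast
    then have "euclid_length (2 * x) (c 0) \<le> n"
      by (metis ballot_nat_eq_0 not_le card_tails)
    then have "(x, c 0) \<in> H" using t(2) by (auto simp: H_def heads_def)
    then show "t \<in> (\<Union>h\<in>H. F h)" using t by (auto simp: F_def)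
  next
    fix t assume "t \<in> (\<Union>h\<in>H. F h)"
    then obtain x y c where t: "t = (x, c)" "c \<in> tails n (2 * x) y" "admissible x y"
      by (auto simp: F_def H_def heads_def)
    then have "c 0 = y" by (simp add: tails_def)
    then show "t \<in> T" using t by (simp add: T_def)
  qed
  moreover have "finite H" using fin by (simp add: H_def)
  moreover have "\<forall>h\<in>H. finite (F h)" by (auto simp: F_def finite_tails)
  moreover have "F h \<inter> F h' = {}" if "h \<noteq> h'" for h h'
    using that by (auto simp: F_def tails_def)
  ultimately have "card T = (\<Sum>h\<in>H. card (F h))" by (simp add: card_UN_disjoint)
  also have "\<dots> = (\<Sum>m\<le>n. \<Sum>h\<in>heads m. card (F h))"
    unfolding H_def using fin by (intro sum.UNION_disjoint) (auto simp: heads_def)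
  also have "\<dots> = (\<Sum>m\<le>n. card (heads m) * ballot_nat n m)"
    by (intro sum.cong) (simp_all add: card_F)
  finally show ?thesis
    using bij_betw_same_card[OF bij_betw_Arith[OF n]] by (simp add: T_def)
qed

section \<open>Ballot and Catalan numbers\<close>

lemma ballot_nat_diag: "ballot_nat n n = 1"
  by (induction n) (simp_all add: ballot_nat_Suc_Suc)

text \<open>The reflection-principle form of the ballot numbers, with \<open>Suc e\<close> the
  distance from \<open>k\<close> to the row index. The outer induction is on \<open>e\<close>, the
  inner one on \<open>k\<close>.\<close>

lemma ballot_nat_binomial_diff:
  "int (ballot_nat (k + Suc e) k) =
     int ((k + 2 * e + 1) choose (Suc e)) - int ((k + 2 * e + 1) choose e)"
proof (induction e arbitrary: k)
  case 0
  show ?case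
  proof (induction k)
    case (Suc k)
    then show ?case using ballot_nat_rec[of "Suc k" k] by (simp add: ballot_nat_diag)
  qed simp
next
  case (Suc e)
  note outer = Suc.IH
  show ?case
  proof (induction k)
    case 0
    \<comment> \<open>For \<open>k = 0\<close> the two binomials are the equal middle entries of an
      odd row.\<close>
    have "(2 * e + 3 choose Suc (Suc e)) = (2 * e + 3 choose Suc e)"
      by (subst binomial_symmetric) simp_all
    then show ?case by (simp add: numeral_3_eq_3)
  next
    case (Suc k)
    \<comment> \<open>The first summand has a smaller \<open>k\<close> at the same distance, the
      second a smaller distance; Pascal's rule combines them.\<close>
    have "int (ballot_nat (Suc k + Suc (Suc e)) (Suc k))
        = int (ballot_nat (k + Suc (Suc e)) k) + int (ballot_nat (Suc (Suc k) + Suc e) (Suc (Suc k)))"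
      using ballot_nat_rec[of "k + Suc (Suc e)" k] by simp
    also have "\<dots> = int (Suc k + 2 * Suc e + 1 choose Suc (Suc e)) - int (Suc k + 2 * Suc e + 1 choose Suc e)"
      unfolding Suc.IH outer by simp
    finally show ?case .
  qed
qed

lemma ballot_nat_eq_ballot:
  assumes "1 \<le> k" "k \<le> n"
  shows "real (ballot_nat n k) = ballot n k"
proof -
  obtain l where k: "k = Suc l" using assms by (cases k) auto
  show ?thesis
  proof (cases "k = n")
    case True
    then show ?thesis using assms by (simp add: ballot_nat_diag ballot_def flip: mult_2)
  next
    case False
    then obtain e where n: "n = k + Suc e" using assms
      by (metis le_neq_implies_less less_imp_Suc_add add_Suc_right)
    define M where "M = k + 2 * e + 1"
    \<comment> \<open>As \<open>M - e = n\<close>, the binomial \<open>M choose e\<close> is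
      \<open>Suc e / n\<close> times \<open>M choose Suc e\<close>, and the difference of the two
      keeps the factor \<open>1 - Suc e / n = k / n\<close>.\<close>
    have "Suc e * (M choose Suc e) = (M - e) * (M choose e)"
      by (metis binomial_absorb_comp binomial_absorption)
    then have "real (Suc e * (M choose Suc e)) = real ((M - e) * (M choose e))"
      by (rule arg_cong)
    then have rel: "(real e + 1) * real (M choose Suc e) = (k + e + 1) * real (M choose e)"
      by (simp add: M_def algebra_simps)
    have "2 * n - k - 1 = M" by (simp add: n M_def)
    moreover have "M choose (n - 1) = M choose Suc e"
      using binomial_symmetric[of "Suc e" M] by (simp add: n M_def k add.commute del: binomial_Suc_Suc)
    ultimately
    have "ballot n k = real k / real n * real (M choose Suc e)"
      by (simp add: ballot_def)
    also have "\<dots> = real (M choose Suc e) - real (M choose e)"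
      using rel by (simp add: n field_simps)
    also have "\<dots> = real_of_int (int (ballot_nat n k))"
      unfolding n ballot_nat_binomial_diff by (simp add: M_def)
    finally show ?thesis by simp
  qed
qed

lemma ballot_nat_1: "real (ballot_nat (Suc n) 1) = catalan n"
  by (simp add: ballot_nat_eq_ballot ballot_def catalan_def add.commute del: One_nat_def)

lemma catalan_pos: "catalan n > 0"
  by (simp add: catalan_def)

lemma catalan_Suc: "catalan (Suc n) * (real n + 2) = catalan n * (2 * (2 * real n + 1))"
proof -
  have "Suc n * (2 * n + 1 choose n) = (2 * n + 1) * (2 * n choose n)"
    using binomial_absorb_comp[of "2 * n + 1" n] by simp
  moreover have "Suc n * (2 * Suc n choose Suc n) = 2 * (Suc n * (2 * n + 1 choose n))"
    using binomial_absorption[of n "2 * Suc n"] by simp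
  ultimately have "Suc n * (2 * Suc n choose Suc n) = 2 * (2 * n + 1) * (2 * n choose n)"
    by (metis mult.assoc)
  then have "real (Suc n * (2 * Suc n choose Suc n)) = real (2 * (2 * n + 1) * (2 * n choose n))"
    by (rule arg_cong)
  then have "real (2 * Suc n choose Suc n) = 2 * (2 * real n + 1) * real (2 * n choose n) / (real n + 1)"
    by (simp add: field_simps del: binomial_Suc_Suc mult_Suc_right)
  then show ?thesis by (simp add: catalan_def field_simps del: binomial_Suc_Suc mult_Suc_right)
qed

section \<open>Growth of Catalan and ballot numbers\<close>

lemma catalan_ratio_tendsto: "(\<lambda>n. catalan n / catalan (Suc n)) \<longlonglongrightarrow> 1 / 4"
proof -
  have "catalan n / catalan (Suc n) = (real n + 2) / (2 * (2 * real n + 1))" for n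
    using catalan_Suc[of n] catalan_pos[of n] catalan_pos[of "Suc n"] by (simp add: field_simps)
  moreover have "(\<lambda>n. (real n + 2) / (2 * (2 * real n + 1))) \<longlonglongrightarrow> 1 / 4"
    by real_asymp
  ultimately show ?thesis by simp
qed

text \<open>\<open>catalan n\<close> is one summand of a row sum whose value is
  \<open>catalan (Suc n)\<close>.\<close>

lemma catalan_le_Suc: "catalan n \<le> catalan (Suc n)"
proof -
  have "ballot_nat (Suc n) 1 \<le> (\<Sum>m = 0..Suc n. ballot_nat (Suc n) m)"
    by (intro member_le_sum) auto
  also have "\<dots> = ballot_nat (Suc (Suc n)) 1"
    by (simp add: ballot_nat_Suc_Suc del: sum.atLeast0_atMost_Suc)
  finally show ?thesis by (simp flip: ballot_nat_1)
qed

text \<open>Raising \<open>k\<close> by one lowers the upper index of the binomial by one. This at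
  least halves it, because \<open>M - (n - 1)\<close> is \<open>n - k\<close>, at most
  \<open>M / 2\<close> for \<open>k \<ge> 1\<close>.\<close>

lemma ballot_Suc_le:
  assumes "1 \<le> k" "k < n"
  shows "2 * real k * ballot n (Suc k) \<le> (real k + 1) * ballot n k"
proof -
  define M where "M = 2 * n - k - 1"
  have "(M - (n - 1)) * (M choose (n - 1)) = M * ((M - 1) choose (n - 1))"
    by (rule binomial_absorb_comp)
  moreover have "2 * (M - (n - 1)) \<le> M" using assms by (simp add: M_def)
  ultimately have "2 * (M * ((M - 1) choose (n - 1))) \<le> M * (M choose (n - 1))"
    by (metis mult.assoc mult_le_mono1)
  moreover have "M > 0" using assms by (simp add: M_def)
  ultimately have "2 * ((M - 1) choose (n - 1)) \<le> M choose (n - 1)"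
    by (metis mult.left_commute nat_mult_le_cancel_disj not_less0)
  then have "2 * real ((M - 1) choose (n - 1)) \<le> real (M choose (n - 1))" by linarith
  then have "real k * (k + 1) / n * (2 * real ((M - 1) choose (n - 1)))
      \<le> real k * (k + 1) / n * real (M choose (n - 1))"
    by (intro mult_left_mono) auto
  moreover have "2 * n - Suc k - 1 = M - 1" by (simp add: M_def)
  ultimately show ?thesis by (simp add: ballot_def M_def algebra_simps add_divide_distrib)
qed

text \<open>The dominating bound for Tannery's theorem, obtained by iterating
  \<open>ballot_Suc_le\<close> from \<open>k = 1\<close>.\<close>

lemma ballot_nat_le: "real (ballot_nat (Suc n) k) \<le> k * (1 / 2) ^ (k - 1) * catalan (Suc n)"
proof (cases "1 \<le> k \<and> k \<le> Suc n")
  case True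
  have "ballot (Suc n) k \<le> k * (1 / 2) ^ (k - 1) * ballot (Suc n) 1"
    using True[THEN conjunct1] True[THEN conjunct2]
  proof (induction k rule: nat_induct_at_least)
    case (Suc k)
    have "2 * real k * ballot (Suc n) (Suc k) \<le> (real k + 1) * ballot (Suc n) k"
      using Suc by (intro ballot_Suc_le) auto
    also have "\<dots> \<le> (real k + 1) * (k * (1 / 2) ^ (k - 1) * ballot (Suc n) 1)"
      using Suc by (intro mult_left_mono) auto
    also have "\<dots> = 2 * real k * (Suc k * (1 / 2) ^ (Suc k - 1) * ballot (Suc n) 1)"
      using Suc(1) by (cases k) auto
    finally show ?case using Suc(1) by (simp add: mult_le_cancel_left_pos)
  qed simp
  also have "ballot (Suc n) 1 = catalan n" by (metis ballot_nat_1 ballot_nat_eq_ballot le_refl le_add1 plus_1_eq_Suc)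
  finally have "ballot (Suc n) k \<le> k * (1 / 2) ^ (k - 1) * catalan n" .
  also have "\<dots> \<le> k * (1 / 2) ^ (k - 1) * catalan (Suc n)"
    by (intro mult_left_mono catalan_le_Suc) auto
  finally show ?thesis using True by (simp add: ballot_nat_eq_ballot)
next
  case False
  then have "ballot_nat (Suc n) k = 0" by (cases k) (auto simp: ballot_nat_eq_0)
  then show ?thesis using catalan_pos[of "Suc n"] by (simp add: less_imp_le)
qed

text \<open>Dividing \<open>ballot_nat_rec\<close> by the Catalan number gives L(k+2) = L(k+1) -
  L(k)/4 for the limits. Its characteristic polynomial has the double root 1/2, and L(0) = 0, L(1) =
  1/4.\<close>

lemma ballot_nat_ratio_tendsto:
  "(\<lambda>n. real (ballot_nat (Suc n) k) / catalan (Suc n)) \<longlonglongrightarrow> real k / 2 ^ (k + 1)"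
proof (induction k rule: less_induct)
  case (less k)
  consider "k = 0" | "k = 1" | l where "k = Suc (Suc l)"
    by (metis One_nat_def nat.exhaust)
  then show ?case
  proof cases
    case 1
    then show ?thesis by simp
  next
    case 2
    then show ?thesis using catalan_ratio_tendsto ballot_nat_1 by simp
  next
    case 3
    let ?g = "\<lambda>k n. real (ballot_nat n k) / catalan n"
    have "(\<lambda>n. ?g l (Suc n)) \<longlonglongrightarrow> real l / 2 ^ (l + 1)"
      using less 3 by simp
    then have "(\<lambda>n. ?g l n) \<longlonglongrightarrow> real l / 2 ^ (l + 1)"
      by (rule LIMSEQ_imp_Suc)
    moreover have "(\<lambda>n. ?g (Suc l) (Suc n)) \<longlonglongrightarrow> real (Suc l) / 2 ^ (Suc l + 1)"
      using less 3 by blast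
    ultimately have "(\<lambda>n. ?g (Suc l) (Suc n) - ?g l n * (catalan n / catalan (Suc n)))
        \<longlonglongrightarrow> real (Suc l) / 2 ^ (Suc l + 1) - real l / 2 ^ (l + 1) * (1 / 4)"
      by (intro tendsto_diff tendsto_mult catalan_ratio_tendsto)
    moreover have "?g (Suc l) (Suc n) - ?g l n * (catalan n / catalan (Suc n)) = ?g k (Suc n)" for n
      using catalan_pos[of n] by (simp add: 3 ballot_nat_rec[of n l] field_simps add_divide_distrib)
    moreover have "real (Suc l) / 2 ^ (Suc l + 1) - real l / 2 ^ (l + 1) * (1 / 4) = real k / 2 ^ (k + 1)"
      by (simp add: 3 field_simps)
    ultimately show ?thesis by simp
  qed
qed

section \<open>Weighted row sums of the ballot numbers\<close>

lemma sum_ballot_nat: "(\<Sum>m\<le>n. ballot_nat n m) = ballot_nat (Suc n) 1"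
  by (simp add: ballot_nat_Suc_Suc atLeast0AtMost)

text \<open>The weight \<open>Suc m\<close> counts the \<open>i \<le> m\<close>. After exchanging
  the sums, the inner ones are entries of row \<open>n + 1\<close>, whose total is an entry of row
  \<open>n + 2\<close>.\<close>

lemma sum_Suc_ballot_nat: "(\<Sum>m\<le>n. Suc m * ballot_nat n m) = ballot_nat (Suc (Suc n)) 1"
proof -
  have "ballot_nat (Suc (Suc n)) 1 = (\<Sum>i\<le>Suc n. ballot_nat (Suc n) i)"
    by (rule sum_ballot_nat[symmetric])
  also have "\<dots> = (\<Sum>i\<le>n. \<Sum>m = i..n. ballot_nat n m)"
    by (simp add: sum.atMost_Suc_shift ballot_nat_Suc_Suc del: sum.atMost_Suc)
  also have "\<dots> = (\<Sum>i\<le>n. \<Sum>m | m \<in> {..n} \<and> i \<le> m. ballot_nat n m)"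
    by (intro sum.cong) auto
  also have "\<dots> = (\<Sum>m\<le>n. \<Sum>i | i \<in> {..n} \<and> i \<le> m. ballot_nat n m)"
    by (rule sum.swap_restrict) auto
  also have "\<dots> = (\<Sum>m\<le>n. \<Sum>i\<le>m. ballot_nat n m)"
    by (intro sum.cong) auto
  finally show ?thesis by simp
qed

text \<open>The weight counts the \<open>j \<ge> 2\<close> with \<open>4 * j \<le> m + 1\<close>;
  truncated subtraction makes it 0 for \<open>m < 7\<close>. Exchanging the sums leaves tail sums of
  row \<open>n\<close> that start at \<open>4 * j - 1\<close>.\<close>

lemma sum_div4_ballot_nat:
  "(\<Sum>m\<le>n. ((m + 1) div 4 - 1) * ballot_nat n m) =
     (\<Sum>j = 2..(n + 1) div 4. ballot_nat (Suc n) (4 * j))"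
proof -
  define J where "J = {2..(n + 1) div 4}"
  have "(\<Sum>m\<le>n. ((m + 1) div 4 - 1) * ballot_nat n m)
      = (\<Sum>m\<le>n. \<Sum>j | j \<in> J \<and> 4 * j \<le> m + 1. ballot_nat n m)"
  proof (intro sum.cong refl)
    fix m assume "m \<in> {..n}"
    then have "{j. j \<in> J \<and> 4 * j \<le> m + 1} = {2..(m + 1) div 4}"
      by (auto simp: J_def intro: order_trans div_le_mono)
    then show "((m + 1) div 4 - 1) * ballot_nat n m = (\<Sum>j | j \<in> J \<and> 4 * j \<le> m + 1. ballot_nat n m)"
      by simp
  qed
  also have "\<dots> = (\<Sum>j\<in>J. \<Sum>m | m \<in> {..n} \<and> 4 * j \<le> m + 1. ballot_nat n m)"
    by (rule sum.swap_restrict) (auto simp: J_def)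
  also have "\<dots> = (\<Sum>j\<in>J. ballot_nat (Suc n) (4 * j))"
  proof (intro sum.cong refl)
    fix j assume "j \<in> J"
    then obtain k where k: "4 * j = Suc k" by (cases "4 * j") (auto simp: J_def)
    then have "{m. m \<in> {..n} \<and> 4 * j \<le> m + 1} = {k..n}" by auto
    then show "(\<Sum>m | m \<in> {..n} \<and> 4 * j \<le> m + 1. ballot_nat n m) = ballot_nat (Suc n) (4 * j)"
      unfolding k by (simp add: ballot_nat_Suc_Suc)
  qed
  finally show ?thesis by (simp add: J_def)
qed

lemma ballot_nat_3: "real (ballot_nat (Suc (Suc n)) 3) = catalan (Suc n) - catalan n"
  using ballot_nat_rec[of "Suc n" 0] ballot_nat_rec[of "Suc n" 1]
    ballot_nat_1[of n] ballot_nat_1[of "Suc n"]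
  by (simp add: numeral_3_eq_3)

lemma ballot_sum_ratio_tendsto:
  "(\<lambda>n. (\<Sum>j = 2..(n + 1) div 4. ballot (n + 1) (4 * j)) / catalan (n + 1)) \<longlonglongrightarrow> 31 / 1800"
proof -
  \<comment> \<open>The index is shifted by 2 so that the series starts at 0. \<open>b\<close> holds
    the termwise limits and \<open>M\<close> the bounds from \<open>ballot_nat_le\<close>.\<close>
  define a where "a j n = real (ballot_nat (Suc n) (4 * j + 8)) / catalan (Suc n)" for j n
  define b where "b j = real (4 * j + 8) / 2 ^ (4 * j + 9)" for j
  define M where "M j = real (4 * j + 8) * (1 / 2) ^ (4 * j + 7)" for j
  \<comment> \<open>As \<open>4 * j + 8 = 4 * (Suc j + 1)\<close>, both series are multiples of the
    sum of the geometric series of ratio 1/16 and its derivative, with values 16/15 and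
    256/225.\<close>
  have geo: "(\<lambda>j. (real (Suc j) * (1 / 16) ^ j + (1 / 16) ^ j) * c) sums ((256 / 225 + 16 / 15) * c)"
    for c :: real
    using geometric_deriv_sums[of "1 / 16 :: real"] geometric_sums[of "1 / 16 :: real"]
    by (intro sums_mult2 sums_add) (simp_all add: power2_eq_square)
  have pow: "(2::real) ^ (4 * j) = 16 ^ j" for j
    by (simp add: power_mult)
  then have pow': "(2::real) ^ (j * 4) = 16 ^ j" for j
    by (simp only: mult.commute)
  have "b = (\<lambda>j. (real (Suc j) * (1 / 16) ^ j + (1 / 16) ^ j) * (1 / 128))"
    by (simp add: b_def power_add pow pow' field_simps fun_eq_iff)
  then have b: "b sums (31 / 1800)" using geo[of "1 / 128"] by simp
  have "M = (\<lambda>j. (real (Suc j) * (1 / 16) ^ j + (1 / 16) ^ j) * (1 / 32))"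
    by (simp add: M_def power_add pow power_divide pow pow' field_simps fun_eq_iff)
  then have M: "summable M" using geo[of "1 / 32"] by (simp add: sums_iff)
  have "((\<lambda>n. suminf (\<lambda>j. a j n)) \<longlongrightarrow> suminf b) sequentially"
  proof (rule tannerys_theorem[THEN conjunct2, THEN conjunct2])
    show "a j \<longlonglongrightarrow> b j" for j
      unfolding a_def b_def using ballot_nat_ratio_tendsto[of "4 * j + 8"] by (simp add: add.commute)
    have "norm (a j n) \<le> M j" for j n
      using ballot_nat_le[of n "4 * j + 8"] catalan_pos[of "Suc n"]
      by (simp add: a_def M_def divide_le_eq add.commute)
    then show "eventually (\<lambda>(j, n). norm (a j n) \<le> M j) (at_top \<times>\<^sub>F sequentially)"
      by (intro always_eventually) auto
  qed (use M in auto)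
  moreover have "suminf (\<lambda>j. a j n) = (\<Sum>j = 2..(n + 1) div 4. ballot (n + 1) (4 * j)) / catalan (n + 1)" for n
  proof -
    define J where "J = (n + 1) div 4"
    \<comment> \<open>Beyond this range \<open>4 * j + 8\<close> exceeds \<open>n + 1\<close>, and
      the ballot number is 0.\<close>
    have "suminf (\<lambda>j. a j n) = (\<Sum>j\<in>{..<J - 1}. a j n)"
      by (intro suminf_finite) (auto simp: a_def J_def ballot_nat_eq_0)
    also have "\<dots> = (\<Sum>j = 2..J. ballot (n + 1) (4 * j) / catalan (n + 1))"
    proof (rule sum.reindex_bij_witness[of _ "\<lambda>j. j - 2" "\<lambda>j. j + 2"])
      fix j assume j: "j \<in> {..<J - 1}"
      then have "4 * (j + 2) \<le> Suc n" by (auto simp: J_def)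
      then show "ballot (n + 1) (4 * (j + 2)) / catalan (n + 1) = a j n"
        using ballot_nat_eq_ballot[of "4 * (j + 2)" "Suc n"] by (simp add: a_def algebra_simps)
    qed auto
    finally show ?thesis by (simp add: J_def sum_divide_distrib)
  qed
  ultimately show ?thesis by (simp only: sums_unique[OF b])
qed

section \<open>Counting the admissible pairs\<close>

text \<open>The representatives modulo the shift \<open>y \<mapsto> y + 2x\<close>.\<close>

definition low_heads :: "nat \<Rightarrow> (nat \<times> nat) set" where
  "low_heads m = {(x, y) \<in> heads m. y < 2 * x}"

lemma admissible_add: "admissible x (y + 2 * x) \<longleftrightarrow> admissible x y"
proof -
  have "x dvd 2 * (y + 2 * x) + 1 \<longleftrightarrow> x dvd 2 * y + 1"
  proof -
    have "2 * (y + 2 * x) + 1 = 2 * y + 1 + x * 4" by simp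
    then show ?thesis by (simp only: dvd_add_left_iff dvd_triv_left)
  qed
  moreover have "z dvd y + 2 * x + 1 \<longleftrightarrow> z dvd y + 1" if "x = 2 * z" for z
  proof -
    have "y + 2 * x + 1 = y + 1 + z * 4" using that by simp
    then show ?thesis by (simp only: dvd_add_left_iff dvd_triv_left)
  qed
  ultimately show ?thesis unfolding admissible_def by auto
qed

text \<open>Length 0 means \<open>y = 0\<close>, which excludes even \<open>x\<close> and turns the
  odd case into \<open>x dvd 1\<close>.\<close>

lemma heads_0: "heads 0 = {(1, 0)}"
  by (auto simp: heads_def admissible_def)

text \<open>If \<open>y \<ge> 2 * x\<close>, subtracting \<open>2 * x\<close> keeps admissibility
  and lowers the length by one.\<close>

lemma heads_Suc: "heads (Suc m) = (\<lambda>(x, y). (x, y + 2 * x)) ` heads m \<union> low_heads (Suc m)"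
proof (intro equalityI subsetI)
  fix h assume "h \<in> heads (Suc m)"
  then obtain x y where h: "h = (x, y)" "admissible x y" "euclid_length (2 * x) y = Suc m"
    by (auto simp: heads_def)
  show "h \<in> (\<lambda>(x, y). (x, y + 2 * x)) ` heads m \<union> low_heads (Suc m)"
  proof (cases "y < 2 * x")
    case True
    then show ?thesis using h by (simp add: low_heads_def heads_def)
  next
    case False
    then obtain y' where y': "y = y' + 2 * x" by (metis le_add_diff_inverse2 not_less)
    have "2 * x > 0" using h(2) by (simp add: admissible_def)
    then have "(x, y') \<in> heads m"
      using h euclid_length_add[of "2 * x" y'] by (simp add: y' heads_def admissible_add)
    then show ?thesis using h y' by force
  qed
next
  fix h assume "h \<in> (\<lambda>(x, y). (x, y + 2 * x)) ` heads m \<union> low_heads (Suc m)"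
  then consider x y where "h = (x, y + 2 * x)" "(x, y) \<in> heads m" | "h \<in> low_heads (Suc m)"
    by auto
  then show "h \<in> heads (Suc m)"
  proof cases
    case 1
    then have "2 * x > 0" by (simp add: heads_def admissible_def)
    then show ?thesis
      using 1 euclid_length_add[of "2 * x" y] by (simp add: heads_def admissible_add)
  qed (auto simp: low_heads_def)
qed

lemma card_heads_Suc:
  assumes "finite (heads m)" "finite (low_heads (Suc m))"
  shows "finite (heads (Suc m)) \<and> card (heads (Suc m)) = card (heads m) + card (low_heads (Suc m))"
proof -
  have "(\<lambda>(x, y). (x, y + 2 * x)) ` heads m \<inter> low_heads (Suc m) = {}"
    by (auto simp: low_heads_def)
  moreover have "card ((\<lambda>(x, y). (x, y + 2 * x)) ` heads m) = card (heads m)"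
    by (intro card_image) (auto simp: inj_on_def)
  ultimately show ?thesis
    using assms by (simp add: heads_Suc card_Un_disjoint)
qed

text \<open>For odd \<open>x\<close> the quotient \<open>(2y + 1) / x\<close> is 1 or 3; for \<open>x = 2z\<close> the quotient \<open>(y + 1) / z\<close> is
  1, 2, 3 or 4. The pairs \<open>(1, 1)\<close> and \<open>(4, 5)\<close>, whose lengths are irregular, are split off from
  the families with quotient 3.\<close>

lemma admissible_low_iff:
  "admissible x y \<and> y < 2 * x \<longleftrightarrow>
     x = 2 * y + 1 \<or> x = 1 \<and> y = 1 \<or> (\<exists>w. x = 2 * w + 3 \<and> y = 3 * w + 4)
   \<or> (\<exists>v. x = 4 * v + 4 \<and> y = 2 * v + 1) \<or> (\<exists>v. x = 2 * v + 2 \<and> y = 2 * v + 1)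
   \<or> x = 4 \<and> y = 5 \<or> (\<exists>w. x = 4 * w + 8 \<and> y = 6 * w + 11) \<or> (\<exists>v. x = 2 * v + 2 \<and> y = 4 * v + 3)"
  (is "_ \<longleftrightarrow> ?rhs")
proof
  assume lhs: "admissible x y \<and> y < 2 * x"
  then have pos: "x > 0" and lt: "y < 2 * x" by (auto simp: admissible_def)
  consider "odd x" "x dvd 2 * y + 1" | z where "x = 2 * z" "odd y" "z dvd y + 1"
    using lhs by (auto simp: admissible_def)
  then show ?rhs
  proof cases
    case 1
    then obtain k where k: "2 * y + 1 = x * k" by auto
    \<comment> \<open>\<open>y < 2 * x\<close> keeps the quotient below 4, and an even quotient is
      impossible because \<open>2 * y + 1\<close> is odd.\<close>
    have "x * k < x * 4" using k lt by linarith
    then have "k < 4" by (metis mult_less_cancel1)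
    moreover have "odd k" using k by (metis even_mult_iff even_Suc Suc_eq_plus1 dvd_triv_left)
    ultimately have "k = 1 \<or> k = 3" by presburger
    then consider "2 * y + 1 = x" | "2 * y + 1 = 3 * x" using k by force
    then show ?thesis
    proof cases
      case (2)
      obtain s where s: "x = 2 * s + 1" using \<open>odd x\<close> by (auto elim: oddE)
      then have y: "y = 3 * s + 1" using 2 by simp
      show ?thesis
      proof (cases s)
        case (Suc w)
        then have "x = 2 * w + 3 \<and> y = 3 * w + 4" using s y by simp
        then show ?thesis by blast
      qed (use s y in simp)
    qed simp
  next
    case 2
    then obtain k where k: "y + 1 = z * k" by auto
    have "z * k \<le> z * 4" using k lt 2 by linarith
    then have "k \<le> 4" using pos 2 by simp
    moreover have "k \<noteq> 0" using k by (metis Suc_eq_plus1 mult_0_right nat.simps(3))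
    ultimately have "k = 1 \<or> k = 2 \<or> k = 3 \<or> k = 4" by presburger
    then consider "y + 1 = z" | "y + 1 = 2 * z" | "y + 1 = 3 * z" | "y + 1 = 4 * z"
      using k by force
    then show ?thesis
    proof cases
      case 1
      obtain t where "y = 2 * t + 1" using \<open>odd y\<close> by (auto elim: oddE)
      then have "x = 4 * t + 4 \<and> y = 2 * t + 1" using 1 2(1) by simp
      then show ?thesis by blast
    next
      case 2
      obtain t where "y = 2 * t + 1" using \<open>odd y\<close> by (auto elim: oddE)
      then have "x = 2 * t + 2 \<and> y = 2 * t + 1" using 2 \<open>x = 2 * z\<close> by simp
      then show ?thesis by blast
    next
      case 3
      \<comment> \<open>This parity makes \<open>x\<close> a multiple of 4 for quotient 3.\<close>
      have "even (3 * z)" using 3 \<open>odd y\<close> by (metis even_Suc Suc_eq_plus1)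
      then have "even z" by simp
      then obtain s where s: "z = 2 * s" by auto
      then have "s = 1 \<or> (\<exists>w. s = w + 2)" using pos 2(1) by presburger
      then show ?thesis
      proof
        assume "s = 1"
        then show ?thesis using 3 2(1) s by simp
      next
        assume "\<exists>w. s = w + 2"
        then obtain w where "s = w + 2" by blast
        then have "x = 4 * w + 8 \<and> y = 6 * w + 11" using 3 2(1) s by simp
        then show ?thesis by blast
      qed
    next
      case 4
      obtain v where "z = v + 1" using pos 2(1) by (metis Suc_eq_plus1 gr0_implies_Suc mult_0_right not_gr_zero)
      then have "x = 2 * v + 2 \<and> y = 4 * v + 3" using 4 2(1) by simp
      then show ?thesis by blast
    qed
  qed
next
  have dvd1: "(2 * w + 3) dvd 2 * (3 * w + 4) + 1" for w :: nat
    by (rule dvdI[of _ _ 3]) simp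
  have dvd2: "(2 * v + 2) dvd 2 * v + 1 + 1" "(v + 1) dvd 2 * v + 1 + 1"
    "(v + 1) dvd 4 * v + 3 + 1" for v :: nat
    by (simp, rule dvdI[of _ _ 2], simp, rule dvdI[of _ _ 4], simp)
  have dvd3: "(2 * w + 4) dvd 6 * w + 11 + 1" for w :: nat
    by (rule dvdI[of _ _ 3]) simp
  assume ?rhs
  then show "admissible x y \<and> y < 2 * x"
  proof (elim disjE exE conjE)
    assume "x = 2 * y + 1"
    then show ?thesis by (simp add: admissible_def)
  next
    fix w assume "x = 2 * w + 3" "y = 3 * w + 4"
    then show ?thesis using dvd1[of w] unfolding admissible_def by simp
  next
    fix v assume "x = 4 * v + 4" "y = 2 * v + 1"
    then show ?thesis using dvd2(1)[of v] unfolding admissible_def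
      by (auto intro!: exI[of _ "2 * v + 2"])
  next
    fix v assume "x = 2 * v + 2" "y = 2 * v + 1"
    then show ?thesis using dvd2(2)[of v] unfolding admissible_def
      by (auto intro!: exI[of _ "v + 1"])
  next
    fix w assume "x = 4 * w + 8" "y = 6 * w + 11"
    then show ?thesis using dvd3[of w] unfolding admissible_def
      by (auto intro!: exI[of _ "2 * w + 4"])
  next
    fix v assume "x = 2 * v + 2" "y = 4 * v + 3"
    then show ?thesis using dvd2(3)[of v] unfolding admissible_def
      by (auto intro!: exI[of _ "v + 1"])
  qed (auto simp: admissible_def intro!: exI[of _ 2])
qed

section \<open>Euclidean lengths of the families\<close>

lemma euclid_length_1: "euclid_length 1 y = y"
  using euclid_length_add_mult[of 1 0 y] by simp

lemma euclid_length_2: "euclid_length 2 y = (y + 1) div 2"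
proof -
  have 1: "euclid_length 2 1 = 1"
    using euclid_length_step[of 0 1 2] by simp
  have "euclid_length 2 y = euclid_length 2 (y mod 2) + y div 2"
    using euclid_length_add_mult[of 2 "y mod 2" "y div 2"] by simp
  also have "\<dots> = (y + 1) div 2"
    using 1 by (cases "even y") (auto elim!: evenE oddE)
  finally show ?thesis .
qed

lemma euclid_length_4_odd:
  "euclid_length 4 (2 * v + 1) = v div 2 + (if even v then 1 else 3)"
proof -
  have 1: "euclid_length 4 1 = 1"
    using euclid_length_step[of 0 1 4] by simp
  have 3: "euclid_length 4 3 = 3"
    using euclid_length_step[of 2 3 4] euclid_length_step[of 1 2 3] by (simp add: euclid_length_2)
  show ?thesis
  proof (cases "even v")
    case True
    then obtain j where "v = 2 * j" by auto
    then show ?thesis using euclid_length_add_mult[of 4 1 j] 1 by (simp add: mult.commute)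
  next
    case False
    then obtain j where j: "v = 2 * j + 1" by (auto elim: oddE)
    then have "euclid_length 4 (2 * v + 1) = euclid_length 4 (3 + j * 4)"
      by (intro arg_cong[of _ _ "euclid_length 4"]) simp
    then show ?thesis using euclid_length_add_mult[of 4 3 j] 3 j by simp
  qed
qed

text \<open>Only the residue of the first entry modulo the second matters, so each pair reduces, in
  some cases after two Euclidean steps, to a first entry 1, 2 or 4. In the last family it is 1, and
  the length is \<open>y\<close> itself.\<close>

lemma euclid_length_low:
  "euclid_length (2 * (2 * t + 1)) t = (t + 1) div 2"
  "euclid_length (2 * 1) 1 = 1"
  "euclid_length (2 * (2 * w + 3)) (3 * w + 4) = 2 + (w + 1) div 2"
  "euclid_length (2 * (4 * v + 4)) (2 * v + 1) = v div 2 + (if even v then 1 else 3)"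
  "euclid_length (2 * (2 * v + 2)) (2 * v + 1) = v + 1"
  "euclid_length (2 * 4) 5 = 3"
  "euclid_length (2 * (4 * w + 8)) (6 * w + 11) = 2 + w div 2 + (if even w then 1 else 3)"
  "euclid_length (2 * (2 * v + 2)) (4 * v + 3) = 4 * v + 3"
proof -
  have red: "euclid_length p q = euclid_length r q" if "p = k * q + r" for p q r k
    using that by (intro euclid_length_cong) simp
  show "euclid_length (2 * (2 * t + 1)) t = (t + 1) div 2"
    by (subst red[of _ 4 _ 2]) (simp_all add: euclid_length_2)
  show "euclid_length (2 * 1) 1 = 1" by (simp add: euclid_length_2)
  show "euclid_length (2 * (2 * w + 3)) (3 * w + 4) = 2 + (w + 1) div 2"
  proof -
    have "euclid_length (2 * (2 * w + 3)) (3 * w + 4) = Suc (euclid_length (3 * w + 4) (2 * w + 2))"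
      by (intro euclid_length_step dvdI[of _ _ 2]) simp_all
    also have "euclid_length (3 * w + 4) (2 * w + 2) = Suc (euclid_length (2 * w + 2) w)"
      by (intro euclid_length_step dvdI[of _ _ 2]) simp_all
    also have "euclid_length (2 * w + 2) w = (w + 1) div 2"
      by (subst red[of _ 2 _ 2]) (simp_all add: euclid_length_2)
    finally show ?thesis by simp
  qed
  show "euclid_length (2 * (4 * v + 4)) (2 * v + 1) = v div 2 + (if even v then 1 else 3)"
    by (subst red[of _ 4 _ 4], simp, rule euclid_length_4_odd)
  show "euclid_length (2 * (2 * v + 2)) (2 * v + 1) = v + 1"
    by (subst red[of _ 2 _ 2]) (simp_all add: euclid_length_2)
  show "euclid_length (2 * 4) 5 = 3"
    using euclid_length_step[of 2 5 8] euclid_length_step[of 1 2 5] by (simp add: euclid_length_2)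
  show "euclid_length (2 * (4 * w + 8)) (6 * w + 11) = 2 + w div 2 + (if even w then 1 else 3)"
  proof -
    have "euclid_length (2 * (4 * w + 8)) (6 * w + 11) = Suc (euclid_length (6 * w + 11) (4 * w + 6))"
      by (intro euclid_length_step dvdI[of _ _ 2]) simp_all
    also have "euclid_length (6 * w + 11) (4 * w + 6) = Suc (euclid_length (4 * w + 6) (2 * w + 1))"
      by (intro euclid_length_step dvdI[of _ _ 2]) simp_all
    also have "euclid_length (4 * w + 6) (2 * w + 1) = w div 2 + (if even w then 1 else 3)"
      by (subst red[of _ 2 _ 4], simp, rule euclid_length_4_odd)
    finally show ?thesis by simp
  qed
  show "euclid_length (2 * (2 * v + 2)) (4 * v + 3) = 4 * v + 3"
    by (subst red[of _ 1 _ 1]) (simp_all add: euclid_length_1 del: One_nat_def)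
qed

text \<open>Each length is solved for the parameter of its family; a division by 2 leaves two
  candidates. The additive equations avoid truncated subtraction, and \<open>y + 0\<close> fits
  \<open>Collect_add_eq_disj\<close>.\<close>

lemma low_heads_eq:
  "low_heads m =
     (\<lambda>y. (2 * y + 1, y)) ` {y. y + 0 = 2 * m \<or> y + 1 = 2 * m}
   \<union> (if m = 1 then {(1, 1)} else {})
   \<union> (\<lambda>w. (2 * w + 3, 3 * w + 4)) ` {w. w + 4 = 2 * m \<or> w + 5 = 2 * m}
   \<union> (\<lambda>v. (4 * v + 4, 2 * v + 1)) ` {v. v + 2 = 2 * m \<or> v + 5 = 2 * m}
   \<union> (\<lambda>v. (2 * v + 2, 2 * v + 1)) ` {v. v + 1 = m}
   \<union> (if m = 3 then {(4, 5)} else {})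
   \<union> (\<lambda>w. (4 * w + 8, 6 * w + 11)) ` {w. w + 6 = 2 * m \<or> w + 9 = 2 * m}
   \<union> (\<lambda>v. (2 * v + 2, 4 * v + 3)) ` {v. 4 * v + 3 = m}" (is "_ = ?R")
proof -
  have lengths:
    "(y + 1) div 2 = m \<longleftrightarrow> y + 0 = 2 * m \<or> y + 1 = 2 * m"
    "2 + (y + 1) div 2 = m \<longleftrightarrow> y + 4 = 2 * m \<or> y + 5 = 2 * m"
    "y div 2 + (if even y then 1 else 3) = m \<longleftrightarrow> y + 2 = 2 * m \<or> y + 5 = 2 * m"
    "2 + y div 2 + (if even y then 1 else 3) = m \<longleftrightarrow> y + 6 = 2 * m \<or> y + 9 = 2 * m" for y :: nat
    by presburger+
  have "(x, y) \<in> low_heads m \<longleftrightarrow> (x, y) \<in> ?R" for x y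
  proof -
    have "(x, y) \<in> low_heads m \<longleftrightarrow> (admissible x y \<and> y < 2 * x) \<and> euclid_length (2 * x) y = m"
      by (auto simp: low_heads_def heads_def)
    also have "\<dots> \<longleftrightarrow>
       x = 2 * y + 1 \<and> euclid_length (2 * (2 * y + 1)) y = m \<or>
       x = 1 \<and> y = 1 \<and> euclid_length (2 * 1) 1 = m \<or>
       (\<exists>w. x = 2 * w + 3 \<and> y = 3 * w + 4 \<and> euclid_length (2 * (2 * w + 3)) (3 * w + 4) = m) \<or>
       (\<exists>v. x = 4 * v + 4 \<and> y = 2 * v + 1 \<and> euclid_length (2 * (4 * v + 4)) (2 * v + 1) = m) \<or>
       (\<exists>v. x = 2 * v + 2 \<and> y = 2 * v + 1 \<and> euclid_length (2 * (2 * v + 2)) (2 * v + 1) = m) \<or>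
       x = 4 \<and> y = 5 \<and> euclid_length (2 * 4) 5 = m \<or>
       (\<exists>w. x = 4 * w + 8 \<and> y = 6 * w + 11 \<and> euclid_length (2 * (4 * w + 8)) (6 * w + 11) = m) \<or>
       (\<exists>v. x = 2 * v + 2 \<and> y = 4 * v + 3 \<and> euclid_length (2 * (2 * v + 2)) (4 * v + 3) = m)"
      unfolding admissible_low_iff by blast
    also have "\<dots> \<longleftrightarrow> (x, y) \<in> ?R"
      unfolding euclid_length_low lengths Un_iff image_iff mem_Collect_eq prod.inject
      by (cases "m = 1"; cases "m = 3") (simp_all del: One_nat_def, blast+)
    finally show ?thesis .
  qed
  then show ?thesis by auto
qed

lemma Collect_add_eq_disj:
  fixes a b N :: nat
  shows "{v. v + a = N \<or> v + b = N} = (if a \<le> N then {N - a} else {}) \<union> (if b \<le> N then {N - b} else {})"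
  by auto

lemma Collect_add_eq:
  fixes a N :: nat
  shows "{v. v + a = N} = (if a \<le> N then {N - a} else {})"
  by auto

lemma Collect_four_mult_add_3_eq:
  "{v. 4 * v + 3 = (m::nat)} = (if m mod 4 = 3 then {m div 4} else {})"
  by (auto; presburger)

lemmas low_heads_simps = low_heads_eq Collect_add_eq_disj Collect_add_eq Collect_four_mult_add_3_eq

lemma low_heads_small:
  "card (low_heads 1) = 5" "card (low_heads 2) = 5" "card (low_heads 3) = 10" "card (low_heads 4) = 8"
  unfolding low_heads_simps by simp_all

text \<open>From 5 on every offset, at most 9, fits below \<open>2 * m\<close>: four families give
  two pairs each and one gives a single pair. The last family adds a pair when
  \<open>4 * v + 3 = m\<close> is solvable.\<close>

lemma card_low_heads_ge_5: "card (low_heads (k + 5)) = 9 + (if (k + 5) mod 4 = 3 then 1 else 0)"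
proof (cases "(k + 5) mod 4 = 3")
  case True
  then have "k = 4 * (k div 4) + 2" by presburger
  then obtain j where "k = 4 * j + 2" by blast
  then show ?thesis unfolding low_heads_simps by simp
next
  case False
  then show ?thesis unfolding low_heads_simps by (auto simp: card_insert_if; presburger)
qed

lemma finite_low_heads: "finite (low_heads m)"
  unfolding low_heads_simps by simp

lemma finite_heads: "finite (heads m)"
proof (induction m)
  case (Suc m)
  then show ?case using card_heads_Suc finite_low_heads by blast
qed (simp add: heads_0)

text \<open>From 5 on the increments are 9, plus 1 when \<open>m mod 4 = 3\<close>. The pair of the
  last family at \<open>m = 3\<close> is already in the constant, hence the \<open>- 1\<close>; the
  7 stands on the left to avoid truncated subtraction.\<close>

lemma card_heads:
  assumes "m \<ge> 1"
  shows "card (heads m) + 7 = 9 * m + (if m = 1 then 4 else 0) + (if m = 3 then 1 else 0)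
    + ((m + 1) div 4 - 1)"
proof -
  note Suc_card = card_heads_Suc[OF finite_heads finite_low_heads, THEN conjunct2]
  have 1: "card (heads 1) = 6"
    using Suc_card[of 0] low_heads_small by (simp add: heads_0)
  have 2: "card (heads 2) = 11"
    using Suc_card[of 1] low_heads_small 1 by (simp add: numeral_2_eq_2)
  have 3: "card (heads 3) = 21"
    using Suc_card[of 2] low_heads_small 2 by simp
  have large: "card (heads (k + 4)) + 7 = 9 * (k + 4) + ((k + 5) div 4 - 1)" for k
  proof (induction k)
    case 0
    show ?case using Suc_card[of 3] low_heads_small 3 by simp
  next
    case (Suc k)
    have "card (heads (Suc k + 4)) = card (heads (k + 4)) + card (low_heads (k + 5))"
      using Suc_card[of "k + 4"] by (simp add: eval_nat_numeral)
    then show ?case using Suc unfolding card_low_heads_ge_5 by (auto; presburger)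
  qed
  show ?thesis
  proof (cases "m \<ge> 4")
    case True
    then obtain k where "m = k + 4" by (metis le_add_diff_inverse2)
    then show ?thesis using large[of k] by simp
  next
    case False
    then have "m = 1 \<or> m = 2 \<or> m = 3" using assms by auto
    then show ?thesis using 1 2 3 by auto
  qed
qed

section \<open>The exact count and its limit\<close>

lemma card_Arith_P2_eq:
  assumes "n \<ge> 2"
  shows "real (card (Arith (P2 n))) =
    9 * catalan (n + 1) - 16 * catalan n + 5 * catalan (n - 1) - catalan (n - 2)
    + (\<Sum>j = 2..(n + 1) div 4. ballot (n + 1) (4 * j))"
proof -
  define B where "B m = real (ballot_nat n m)" for m
  define D where "D m = real ((m + 1) div 4 - 1)" for m
  obtain k where n: "n = Suc (Suc k)" using assms by (metis add_2_eq_Suc le_Suc_ex)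
  have B0: "B 0 = 0" by (simp add: B_def n)
  \<comment> \<open>\<open>9 * m - 7\<close> is written as \<open>9 * Suc m - 16\<close> to match
    the two row sums. The formula for \<open>card (heads m)\<close> fails at \<open>m = 0\<close>,
    where \<open>B 0 = 0\<close> absorbs it.\<close>
  have heads: "real (card (heads m)) * B m = 9 * (real (Suc m) * B m) - 16 * B m
      + (if m = 1 then 4 * B m else 0) + (if m = 3 then B m else 0) + D m * B m" for m
  proof (cases "m = 0")
    case False
    then have "real (card (heads m)) + 7 = 9 * real m + (if m = 1 then 4 else 0)
        + (if m = 3 then 1 else 0) + D m"
      using arg_cong[OF card_heads[of m], of real] by (auto simp: D_def)
    then have eq: "real (card (heads m)) = 9 * real (Suc m) - 16 + (if m = 1 then 4 else 0)
        + (if m = 3 then 1 else 0) + D m" by simp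
    show ?thesis unfolding eq by (simp add: algebra_simps)
  qed (simp add: B0)
  have "real (card (Arith (P2 n))) = (\<Sum>m\<le>n. real (card (heads m)) * B m)"
    using card_Arith_P2[OF _ finite_heads, of n] assms by (simp add: B_def)
  also have "\<dots> = 9 * (\<Sum>m\<le>n. real (Suc m) * B m) - 16 * (\<Sum>m\<le>n. B m)
      + (\<Sum>m\<le>n. if m = 1 then 4 * B m else 0) + (\<Sum>m\<le>n. if m = 3 then B m else 0)
      + (\<Sum>m\<le>n. D m * B m)"
    unfolding heads by (simp only: sum.distrib sum_subtractf sum_distrib_left)
  also have "(\<Sum>m\<le>n. real (Suc m) * B m) = catalan (n + 1)"
    using arg_cong[OF sum_Suc_ballot_nat[of n], of real] ballot_nat_1[of "Suc n"]
    by (simp add: B_def algebra_simps)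
  also have "(\<Sum>m\<le>n. B m) = catalan n"
    using arg_cong[OF sum_ballot_nat[of n], of real] ballot_nat_1[of n] by (simp add: B_def)
  \<comment> \<open>The corrections at \<open>m = 1\<close> and \<open>m = 3\<close> together give
    \<open>5 * catalan (n - 1) - catalan (n - 2)\<close>.\<close>
  also have "(\<Sum>m\<le>n. if m = 1 then 4 * B m else 0) = 4 * catalan (n - 1)"
    using ballot_nat_1[of "Suc k"] by (auto simp: B_def n)
  also have "(\<Sum>m\<le>n. if m = 3 then B m else 0) = catalan (n - 1) - catalan (n - 2)"
  proof -
    have "(\<Sum>m\<le>n. if m = 3 then B m else 0) = (if 3 \<le> n then B 3 else 0)"
      by (subst sum.delta) simp_all
    \<comment> \<open>For \<open>n = 2\<close> the index 3 lies outside the row, and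
      \<open>B 3\<close> is 0.\<close>
    also have "\<dots> = B 3" by (simp add: B_def ballot_nat_eq_0)
    also have "\<dots> = catalan (n - 1) - catalan (n - 2)"
      using ballot_nat_3[of k] by (simp only: B_def n diff_Suc_1 diff_Suc_Suc numeral_2_eq_2 diff_zero)
    finally show ?thesis .
  qed
  also have "(\<Sum>m\<le>n. D m * B m) = (\<Sum>j = 2..(n + 1) div 4. ballot (n + 1) (4 * j))"
  proof -
    have "(\<Sum>m\<le>n. D m * B m) = real (\<Sum>j = 2..(n + 1) div 4. ballot_nat (Suc n) (4 * j))"
      unfolding sum_div4_ballot_nat[symmetric] by (simp add: B_def D_def)
    also have "\<dots> = (\<Sum>j = 2..(n + 1) div 4. real (ballot_nat (Suc n) (4 * j)))" by simp
    also have "\<dots> = (\<Sum>j = 2..(n + 1) div 4. ballot (n + 1) (4 * j))"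
      by (intro sum.cong refl) (subst ballot_nat_eq_ballot, auto)
    finally show ?thesis .
  qed
  finally show ?thesis by simp
qed

lemma card_Arith_P2_ratio_tendsto:
  "(\<lambda>n. real (card (Arith (P2 n))) / catalan (n + 1)) \<longlonglongrightarrow> 76523 / 14400"
proof (rule LIMSEQ_offset[where k = 2])
  let ?s = "\<lambda>n. \<Sum>j = 2..(n + 1) div 4. ballot (n + 1) (4 * j)"
  define q where "q n = catalan n / catalan (Suc n)" for n
  have q: "q \<longlonglongrightarrow> 1 / 4" unfolding q_def by (rule catalan_ratio_tendsto)
  have q1: "(\<lambda>n. q (n + 1)) \<longlonglongrightarrow> 1 / 4" and q2: "(\<lambda>n. q (n + 2)) \<longlonglongrightarrow> 1 / 4"
    using q by (rule LIMSEQ_ignore_initial_segment)+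
  have s: "(\<lambda>n. ?s (n + 2) / catalan (n + 2 + 1)) \<longlonglongrightarrow> 31 / 1800"
    using ballot_sum_ratio_tendsto by (rule LIMSEQ_ignore_initial_segment)
  \<comment> \<open>Ratios of Catalan numbers two or three indices apart are products of consecutive
    ratios, each tending to 1/4. The offset 2 is where the exact formula starts.\<close>
  have "(\<lambda>n. 9 - 16 * q (n + 2) + 5 * (q (n + 1) * q (n + 2)) - q n * (q (n + 1) * q (n + 2))
      + ?s (n + 2) / catalan (n + 2 + 1))
    \<longlonglongrightarrow> 9 - 16 * (1 / 4) + 5 * (1 / 4 * (1 / 4)) - 1 / 4 * (1 / 4 * (1 / 4)) + 31 / 1800"
    by (intro tendsto_add tendsto_diff tendsto_mult tendsto_const q q1 q2 s)
  moreover have "real (card (Arith (P2 (n + 2)))) / catalan (n + 2 + 1)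
      = 9 - 16 * q (n + 2) + 5 * (q (n + 1) * q (n + 2)) - q n * (q (n + 1) * q (n + 2))
        + ?s (n + 2) / catalan (n + 2 + 1)" for n
  proof -
    have shift: "n + 2 + 1 = n + 3" "n + 2 - 1 = n + 1" "n + 2 - 2 = n" by simp_all
    have pos: "catalan (n + 3) > 0" "catalan (n + 2) > 0" "catalan (n + 1) > 0"
      by (rule catalan_pos)+
    have "q (n + 2) = catalan (n + 2) / catalan (n + 3)" "q (n + 1) * q (n + 2) = catalan (n + 1) / catalan (n + 3)"
      "q n * (q (n + 1) * q (n + 2)) = catalan n / catalan (n + 3)"
      using pos by (simp_all add: q_def eval_nat_numeral)
    moreover have "real (card (Arith (P2 (n + 2)))) = 9 * catalan (n + 3) - 16 * catalan (n + 2)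
        + 5 * catalan (n + 1) - catalan n + ?s (n + 2)"
      using card_Arith_P2_eq[of "n + 2"] unfolding shift by simp
    ultimately show ?thesis
      using pos(1) unfolding shift by (simp add: add_divide_distrib diff_divide_distrib)
  qed
  ultimately show "(\<lambda>n. real (card (Arith (P2 (n + 2)))) / catalan (n + 2 + 1)) \<longlonglongrightarrow> 76523 / 14400"
    by simp
qed

theorem theorem4p3:
  shows "(\<forall>n::nat. n \<ge> 2 \<longrightarrow>
            real (card (Arith (P2 n))) =
              9 * catalan (n + 1) - 16 * catalan n + 5 * catalan (n - 1) - catalan (n - 2)
              + (\<Sum>j = 2..(n + 1) div 4. ballot (n + 1) (4 * j)))
       \<and> (\<lambda>n. real (card (Arith (P2 n))) / catalan (n + 1)) \<longlonglongrightarrow> 76523 / 14400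
       \<and> \<bar>76523 / 14400 - (5.3141::real)\<bar> \<le> 0.00005"
proof (intro conjI allI impI)
  fix n :: nat
  assume "n \<ge> 2"
  then show "real (card (Arith (P2 n))) =
      9 * catalan (n + 1) - 16 * catalan n + 5 * catalan (n - 1) - catalan (n - 2)
      + (\<Sum>j = 2..(n + 1) div 4. ballot (n + 1) (4 * j))"
    by (rule card_Arith_P2_eq)
next
  show "(\<lambda>n. real (card (Arith (P2 n))) / catalan (n + 1)) \<longlonglongrightarrow> 76523 / 14400"
    by (rule card_Arith_P2_ratio_tendsto)
qed simp

end
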